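(* For every $j\in\{0,\dots,M\}$ let $N_j\in\mathbb{N}$, and let $\theta_{j,n}\in\mathbb{R}$, $w_{j,n}\in\mathbb{R}_+$, $n\in\{1,\dots,N_j\}$, be constants with $\sum_{n=1}^{N_j}w_{j,n}=1$. For $k\in\{1,\dots,M\}$ let $L_k\in\mathbb{N}$, and for all $\ell_i\in\{1,\dots,L_i\}$, $1\le i\le k$, let $z^{\ell_1,\dots,\ell_{k-1}}_{\ell_k}\in\mathbb{R}^+$ and $v^{\ell_1,\dots,\ell_{k-1}}_{\ell_k}\in\mathbb{R}^+$ be constants such that $\sum_{\ell_k=1}^{L_k}v^{\ell_1,\dots,\ell_{k-1}}_{\ell_k}=1$. For $\bm\ell=(\ell_1,\dots,\ell_M)$ put $\bm z_{\bm\ell}=(z_{\ell_1},z^{\ell_1}_{\ell_2},\dots,z^{\ell_1,\dots,\ell_{M-1}}_{\ell_M})$ and $V_{\bm\ell}=\prod_{k=1}^M v^{\ell_1,\dots,\ell_{k-1}}_{\ell_k}$. Let $\widehat X_M(t)$ be the associated local volatility process defined in the context. Then the characteristic function of $\widehat X_M(t)$ is given for every $u\in\mathbb{R}$, $t\ge0$ and $M\in\mathbb{N}$ by $$\varphi(u;\widehat X_M(t))=e^{iux_0}\sum_{\bm\ell}V_{\bm\ell}\prod_{j=0}^M\sum_{n_j=1}^{N_j}w_{j,n_j}\,\varphi\bigl(u;Y_j^{\theta_{j,n_j}}(s_j^{\bm z_{\bm\ell}}(t))\bigr),$$ where the sum runs over all $\bm\ell$ with $1\le\ell_k\le L_k$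.
   Context: Fix $M\in\mathbb{N}$, $x_0\in\mathbb{R}$, $\lambda\ge0$ and a cdf $F_\eta$. For $j\in\{0,\dots,M\}$ let $W_j$ be a standard Brownian motion, $P_j$ a Poisson process with intensity $\lambda$, and $\eta_j(1),\eta_j(2),\dots$ i.i.d. real random variables with cdf $F_\eta$; all these are mutually independent. Let $b_j(t,z),\sigma_j(t,z)$ be real-valued functions, finite for all $t\ge0$ and bounded for all $z\in\mathbb{R}$. For $\theta\in\mathbb{R}$ the conditional component process is $$Y_j^{\theta}(t)=\int_0^t b_j(u,\theta)\,\mathrm{d}u+\int_0^t\sigma_j(u,\theta)\,\mathrm{d}W_j(u)+\sum_{i=1}^{P_j(t)}\eta_j(i).$$ For positive sojourn times $\bm z=(z_1,\dots,z_M)$ let $\tau_0=0$, $\tau_j=\sum_{k=1}^jz_k$ ($\tau_{M+1}=\infty$), and let $s_j^{\bm z}(t)=0$ for $t<\tau_j$, $s_j^{\bm z}(t)=t-\tau_j$ for $\tau_j\le t<\tau_{j+1}$, $s_j^{\bm z}(t)=\tau_{j+1}-\tau_j$ for $t\ge\tau_{j+1}$. For $\bm\theta=(\theta_0,\dots,\theta_M)\in\mathbb{R}^{M+1}$ put $X^{\bm z,\bm\theta}(t)=x_0+\sum_{j=0}^MY_j^{\theta_j}(s_j^{\bm z}(t))$ and $$\beta(t;\bm z,\bm\theta)=\sum_{j=0}^M b_j(s_j^{\bm z}(t),\theta_j)\mathbf 1_{t\in[\tau_j,\tau_{j+1})},\qquad \gamma(t;\bm z,\bm\theta)=\sum_{j=0}^M\sigma_j(s_j^{\bm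 z}(t),\theta_j)\mathbf 1_{t\in[\tau_j,\tau_{j+1})}.$$ $f(x;Z)$ is the probability density function of $Z$ at $x$ and $\varphi(u;Z)=\mathbb{E}[e^{iuZ}]$. Local volatility process: for $\bm n=(n_0,\dots,n_M)$, $1\le n_j\le N_j$, put $\bm\theta_{\bm n}=(\theta_{0,n_0},\dots,\theta_{M,n_M})$ and $w_{\bm n}=\prod_{j=0}^Mw_{j,n_j}$. The process $\widehat X_M(t)$ is the strong solution of $$\mathrm{d}\widehat X_M(t)=\widehat\mu_M(t,\widehat X_M(t))\,\mathrm{d}t+\widehat\sigma_M(t,\widehat X_M(t))\,\mathrm{d}\widehat W(t)+\widehat\eta(t)\,\mathrm{d}\widehat N(t),\qquad\widehat X_M(0)=x_0,$$ with $\widehat W$ a standard Brownian motion, $\widehat N$ a Poisson process with intensity $\lambda$, jump sizes $\widehat\eta$ with cdf $F_\eta$, and $$\widehat\mu_M(t,x)=\frac{\sum_{\bm\ell,\bm n}V_{\bm\ell}w_{\bm n}\beta(t;\bm z_{\bm\ell},\bm\theta_{\bm n})f(x;X^{\bm z_{\bm\ell},\bm\theta_{\bm n}}(t))}{\sum_{\bm\ell,\bm n}V_{\bm\ell}w_{\bm n}f(x;X^{\bm z_{\bm\ell},\bm\theta_{\bm n}}(t))},\qquad\widehat\sigma_M^2(t,x)=\frac{\sum_{\bm\ell,\bm n}V_{\bm\ell}w_{\bm n}\gamma^2(t;\bm z_{\bm\ell},\bm\theta_{\bm n})f(x;X^{\bm z_{\bm\ell},\bm\theta_{\bm n}}(t))}{\sum_{\bm\ell,\bm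 n}V_{\bm\ell}w_{\bm n}f(x;X^{\bm z_{\bm\ell},\bm\theta_{\bm n}}(t))}.$$ It has probability density function $\sum_{\bm\ell,\bm n}V_{\bm\ell}w_{\bm n}f(x;X^{\bm z_{\bm\ell},\bm\theta_{\bm n}}(t))$. *)

theory Defs
  imports "HOL-Probability.Probability"
begin

section \<open>Driving noise\<close>

text \<open>Processes are functions of time (a real, only times \<open>t \<ge> 0\<close> matter) and of the outcome.\<close>

definition independent_increments :: "'a measure \<Rightarrow> (real \<Rightarrow> 'a \<Rightarrow> real) \<Rightarrow> bool" where
  "independent_increments \<Omega> X \<longleftrightarrow>
     (\<forall>n p. 0 \<le> p 0 \<longrightarrow> (\<forall>i<n. p i \<le> p (Suc i)) \<longrightarrow>
        prob_space.indep_vars \<Omega> (\<lambda>_. borel) (\<lambda>i \<omega>. X (p (Suc i)) \<omega> - X (p i) \<omega>) {..<n::nat})"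

definition brownian_motion :: "'a measure \<Rightarrow> (real \<Rightarrow> 'a \<Rightarrow> real) \<Rightarrow> bool" where
  "brownian_motion \<Omega> W \<longleftrightarrow>
     (\<forall>t\<ge>0. W t \<in> borel_measurable \<Omega>) \<and>
     (AE \<omega> in \<Omega>. W 0 \<omega> = 0) \<and>
     (AE \<omega> in \<Omega>. continuous_on {0..} (\<lambda>t. W t \<omega>)) \<and>
     independent_increments \<Omega> W \<and>
     (\<forall>s t. 0 \<le> s \<longrightarrow> s < t \<longrightarrow>
        distributed \<Omega> lborel (\<lambda>\<omega>. W t \<omega> - W s \<omega>) (\<lambda>x. ennreal (normal_density 0 (sqrt (t - s)) x)))"

text \<open>The increment law is written out because the intensity may be 0, which
  \<open>poisson_pmf\<close> does not cover.\<close>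

definition poisson_process :: "'a measure \<Rightarrow> real \<Rightarrow> (real \<Rightarrow> 'a \<Rightarrow> nat) \<Rightarrow> bool" where
  "poisson_process \<Omega> lam P \<longleftrightarrow>
     (\<forall>t\<ge>0. P t \<in> measurable \<Omega> (count_space UNIV)) \<and>
     (AE \<omega> in \<Omega>. P 0 \<omega> = 0) \<and>
     (AE \<omega> in \<Omega>. \<forall>s t. 0 \<le> s \<longrightarrow> s \<le> t \<longrightarrow> P s \<omega> \<le> P t \<omega>) \<and>
     (AE \<omega> in \<Omega>. \<forall>t\<ge>0. continuous (at_right t) (\<lambda>s. real (P s \<omega>))) \<and>
     independent_increments \<Omega> (\<lambda>t \<omega>. real (P t \<omega>)) \<and>
     (\<forall>s t k. 0 \<le> s \<longrightarrow> s \<le> t \<longrightarrow>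
        measure \<Omega> {\<omega> \<in> space \<Omega>. P t \<omega> = P s \<omega> + k}
          = exp (- (lam * (t - s))) * (lam * (t - s)) ^ k / fact k)"

text \<open>Mutual independence of several processes and variables is independence of the
  \<open>\<sigma>\<close>-algebras they generate; the following type indexes these \<open>\<sigma>\<close>-algebras.\<close>

datatype 'j source = Brownian 'j | Poisson 'j | Jump 'j nat

fun source_events ::
  "'a measure \<Rightarrow> ('j \<Rightarrow> real \<Rightarrow> 'a \<Rightarrow> real) \<Rightarrow> ('j \<Rightarrow> real \<Rightarrow> 'a \<Rightarrow> nat) \<Rightarrow> ('j \<Rightarrow> nat \<Rightarrow> 'a \<Rightarrow> real) \<Rightarrow>
   'j source \<Rightarrow> 'a set set" where
  "source_events \<Omega> W P \<eta> (Brownian j) =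
     sigma_sets (space \<Omega>) {W j s -` A \<inter> space \<Omega> | s A. 0 \<le> s \<and> A \<in> sets borel}"
| "source_events \<Omega> W P \<eta> (Poisson j) =
     sigma_sets (space \<Omega>) {P j s -` A \<inter> space \<Omega> | s A. 0 \<le> s}"
| "source_events \<Omega> W P \<eta> (Jump j i) = {\<eta> j i -` A \<inter> space \<Omega> | A. A \<in> sets borel}"

text \<open>Jump sizes are numbered from 1.\<close>

definition driving_noise ::
  "'a measure \<Rightarrow> 'j set \<Rightarrow> real \<Rightarrow> (real \<Rightarrow> real) \<Rightarrow> ('j \<Rightarrow> real \<Rightarrow> 'a \<Rightarrow> real) \<Rightarrow>
   ('j \<Rightarrow> real \<Rightarrow> 'a \<Rightarrow> nat) \<Rightarrow> ('j \<Rightarrow> nat \<Rightarrow> 'a \<Rightarrow> real) \<Rightarrow> bool" where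
  "driving_noise \<Omega> J lam F W P \<eta> \<longleftrightarrow>
     (\<forall>j\<in>J. brownian_motion \<Omega> (W j)) \<and>
     (\<forall>j\<in>J. poisson_process \<Omega> lam (P j)) \<and>
     (\<forall>j\<in>J. \<forall>i\<ge>1. \<eta> j i \<in> borel_measurable \<Omega> \<and> cdf (distr \<Omega> borel (\<eta> j i)) = F) \<and>
     prob_space.indep_sets \<Omega> (source_events \<Omega> W P \<eta>)
       (Brownian ` J \<union> Poisson ` J \<union> {Jump j i | j i. j \<in> J \<and> 1 \<le> i})"


section \<open>The Ito integral\<close>

definition natural_filtration ::
  "'a measure \<Rightarrow> (real \<Rightarrow> 'a \<Rightarrow> real) set \<Rightarrow> real \<Rightarrow> 'a measure" where
  "natural_filtration \<Omega> XS t =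
     sigma (space \<Omega>) {X s -` A \<inter> space \<Omega> | X s A. X \<in> XS \<and> 0 \<le> s \<and> s \<le> t \<and> A \<in> sets borel}"

definition augmented_filtration ::
  "'a measure \<Rightarrow> (real \<Rightarrow> 'a \<Rightarrow> real) set \<Rightarrow> real \<Rightarrow> 'a measure" where
  "augmented_filtration \<Omega> XS t =
     sigma (space \<Omega>) (sets (natural_filtration \<Omega> XS t) \<union> null_sets \<Omega>)"

text \<open>An elementary integrand is \<open>\<Sum>i<n. \<xi> i * 1_{(p i, p (i+1)]}\<close> with \<open>0 \<le> p 0 \<le> \<dots> \<le> p n\<close> and
  \<open>\<xi> i\<close> bounded and measurable at time \<open>p i\<close>.\<close>

definition elementary_integrand ::
  "'a measure \<Rightarrow> (real \<Rightarrow> 'a measure) \<Rightarrow> nat \<Rightarrow> (nat \<Rightarrow> real) \<Rightarrow> (nat \<Rightarrow> 'a \<Rightarrow> real) \<Rightarrow> bool" where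
  "elementary_integrand \<Omega> F n p \<xi> \<longleftrightarrow>
     0 \<le> p 0 \<and> (\<forall>i<n. p i \<le> p (Suc i)) \<and>
     (\<forall>i<n. \<xi> i \<in> borel_measurable (F (p i)) \<and> bounded (\<xi> i ` space \<Omega>))"

definition elementary_process ::
  "nat \<Rightarrow> (nat \<Rightarrow> real) \<Rightarrow> (nat \<Rightarrow> 'a \<Rightarrow> real) \<Rightarrow> real \<Rightarrow> 'a \<Rightarrow> real" where
  "elementary_process n p \<xi> t \<omega> = (\<Sum>i<n. \<xi> i \<omega> * indicator {p i<..p (Suc i)} t)"

definition elementary_integral ::
  "(real \<Rightarrow> 'a \<Rightarrow> real) \<Rightarrow> nat \<Rightarrow> (nat \<Rightarrow> real) \<Rightarrow> (nat \<Rightarrow> 'a \<Rightarrow> real) \<Rightarrow> real \<Rightarrow> 'a \<Rightarrow> real" where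
  "elementary_integral W n p \<xi> t \<omega> =
     (\<Sum>i<n. \<xi> i \<omega> * (W (min t (p (Suc i))) \<omega> - W (min t (p i)) \<omega>))"

text \<open>\<open>ito_integral \<Omega> F W H I\<close>: the process \<open>I\<close> is (a continuous version of)
  \<open>t \<mapsto> \<integral>\<^sub>0\<^sup>t H dW\<close>.  This is the extended integral, for \<open>H\<close> with almost surely locally
  square-integrable paths: there are elementary \<open>H\<^sub>k\<close> with \<open>\<integral>\<^sub>0\<^sup>T (H\<^sub>k - H)\<^sup>2 ds \<rightarrow> 0\<close> in
  probability for every \<open>T\<close>, and \<open>I t\<close> is the limit in probability of the elementary
  integrals.  It determines \<open>I\<close> up to indistinguishability.  The value of \<open>H\<close> at time 0 is
  irrelevant.  \<open>W\<close> is meant to be a Brownian motion with respect to \<open>F\<close>.\<close>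

definition ito_integral ::
  "'a measure \<Rightarrow> (real \<Rightarrow> 'a measure) \<Rightarrow> (real \<Rightarrow> 'a \<Rightarrow> real) \<Rightarrow> (real \<Rightarrow> 'a \<Rightarrow> real) \<Rightarrow>
   (real \<Rightarrow> 'a \<Rightarrow> real) \<Rightarrow> bool" where
  "ito_integral \<Omega> F W H I \<longleftrightarrow>
     (\<lambda>(s, \<omega>). H s \<omega>) \<in> borel_measurable (restrict_space borel {0<..} \<Otimes>\<^sub>M \<Omega>) \<and>
     (\<forall>t\<ge>0. I t \<in> borel_measurable \<Omega>) \<and>
     (AE \<omega> in \<Omega>. continuous_on {0..} (\<lambda>t. I t \<omega>)) \<and>
     (\<exists>n p \<xi>.
        (\<forall>k::nat. elementary_integrand \<Omega> F (n k) (p k) (\<xi> k)) \<and>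
        (\<forall>T\<ge>0. \<forall>\<epsilon>>0.
           (\<lambda>k. measure \<Omega> {\<omega> \<in> space \<Omega>. ennreal \<epsilon> <
                 (\<integral>\<^sup>+s\<in>{0<..T}. ennreal ((elementary_process (n k) (p k) (\<xi> k) s \<omega> - H s \<omega>)\<^sup>2) \<partial>lborel)})
             \<longlonglongrightarrow> 0) \<and>
        (\<forall>t\<ge>0. \<forall>\<epsilon>>0.
           (\<lambda>k. measure \<Omega> {\<omega> \<in> space \<Omega>.
                 \<epsilon> < \<bar>elementary_integral W (n k) (p k) (\<xi> k) t \<omega> - I t \<omega>\<bar>})
             \<longlonglongrightarrow> 0))"


section \<open>Component processes and their composition\<close>

text \<open>Besides boundedness in the parameter, the coefficients must be such that the integrals in
  the component process exist.\<close>

definition admissible_coefficients :: "(real \<Rightarrow> real \<Rightarrow> real) \<Rightarrow> (real \<Rightarrow> real \<Rightarrow> real) \<Rightarrow> bool" where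
  "admissible_coefficients b \<sigma> \<longleftrightarrow>
     (\<forall>t\<ge>0. bounded (range (b t)) \<and> bounded (range (\<sigma> t))) \<and>
     (\<forall>\<theta>. \<forall>T\<ge>0.
        set_integrable lborel {0..T} (\<lambda>u. b u \<theta>) \<and>
        set_borel_measurable lborel {0..T} (\<lambda>u. \<sigma> u \<theta>) \<and>
        set_integrable lborel {0..T} (\<lambda>u. (\<sigma> u \<theta>)\<^sup>2))"

definition component_process ::
  "'a measure \<Rightarrow> (real \<Rightarrow> real \<Rightarrow> real) \<Rightarrow> (real \<Rightarrow> real \<Rightarrow> real) \<Rightarrow> (real \<Rightarrow> 'a \<Rightarrow> real) \<Rightarrow>
   (real \<Rightarrow> 'a \<Rightarrow> nat) \<Rightarrow> (nat \<Rightarrow> 'a \<Rightarrow> real) \<Rightarrow> real \<Rightarrow> (real \<Rightarrow> 'a \<Rightarrow> real) \<Rightarrow> bool" where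
  "component_process \<Omega> b \<sigma> W P \<eta> \<theta> Y \<longleftrightarrow>
     (\<forall>t\<ge>0. Y t \<in> borel_measurable \<Omega>) \<and>
     (\<exists>I. ito_integral \<Omega> (natural_filtration \<Omega> {W}) W (\<lambda>u _. \<sigma> u \<theta>) I \<and>
        (AE \<omega> in \<Omega>. \<forall>t\<ge>0.
           Y t \<omega> = (LINT u:{0..t}|lborel. b u \<theta>) + I t \<omega> + (\<Sum>i=1..P t \<omega>. \<eta> i \<omega>)))"

definition switch_time :: "(nat \<Rightarrow> real) \<Rightarrow> nat \<Rightarrow> real" where
  "switch_time z j = (\<Sum>k=1..j. z k)"

text \<open>The guards \<open>j < M\<close> below encode the convention \<open>\<tau> (M+1) = \<infinity>\<close>.\<close>

definition sojourn_interval :: "nat \<Rightarrow> (nat \<Rightarrow> real) \<Rightarrow> nat \<Rightarrow> real set" where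
  "sojourn_interval M z j =
     {t. switch_time z j \<le> t \<and> (j < M \<longrightarrow> t < switch_time z (Suc j))}"

definition local_time :: "nat \<Rightarrow> (nat \<Rightarrow> real) \<Rightarrow> nat \<Rightarrow> real \<Rightarrow> real" where
  "local_time M z j t =
     (if t < switch_time z j then 0
      else if j < M \<and> switch_time z (Suc j) \<le> t then switch_time z (Suc j) - switch_time z j
      else t - switch_time z j)"

definition composite_process ::
  "nat \<Rightarrow> real \<Rightarrow> (nat \<Rightarrow> real \<Rightarrow> real \<Rightarrow> 'a \<Rightarrow> real) \<Rightarrow> (nat \<Rightarrow> real) \<Rightarrow> (nat \<Rightarrow> real) \<Rightarrow>
   real \<Rightarrow> 'a \<Rightarrow> real" where
  "composite_process M x0 Y z \<theta> t \<omega> = x0 + (\<Sum>j=0..M. Y j (\<theta> j) (local_time M z j t) \<omega>)"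

text \<open>Both \<open>\<beta>\<close> and \<open>\<gamma>\<close> are instances of this, for \<open>c = b\<close> and \<open>c = \<sigma>\<close>.\<close>

definition composite_coefficient ::
  "nat \<Rightarrow> (nat \<Rightarrow> real \<Rightarrow> real \<Rightarrow> real) \<Rightarrow> real \<Rightarrow> (nat \<Rightarrow> real) \<Rightarrow> (nat \<Rightarrow> real) \<Rightarrow> real" where
  "composite_coefficient M c t z \<theta> =
     (\<Sum>j=0..M. c j (local_time M z j t) (\<theta> j) * indicator (sojourn_interval M z j) t)"


section \<open>Weighted parameter families\<close>

definition sojourn_indices :: "nat \<Rightarrow> (nat \<Rightarrow> nat) \<Rightarrow> (nat \<Rightarrow> nat) set" where
  "sojourn_indices M L = PiE {1..M} (\<lambda>k. {1..L k})"

definition parameter_indices :: "nat \<Rightarrow> (nat \<Rightarrow> nat) \<Rightarrow> (nat \<Rightarrow> nat) set" where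
  "parameter_indices M N = PiE {0..M} (\<lambda>j. {1..N j})"

text \<open>The upper indices: a constant with upper indices \<open>l 1, \<dots>, l (k-1)\<close> and lower index \<open>l k\<close> is
  written \<open>z [l 1, \<dots>, l (k-1)] (l k)\<close>.\<close>

definition history :: "(nat \<Rightarrow> nat) \<Rightarrow> nat \<Rightarrow> nat list" where
  "history l k = map l [1..<k]"

definition sojourn_times :: "(nat list \<Rightarrow> nat \<Rightarrow> real) \<Rightarrow> (nat \<Rightarrow> nat) \<Rightarrow> nat \<Rightarrow> real" where
  "sojourn_times z l k = z (history l k) (l k)"

definition sojourn_weight :: "nat \<Rightarrow> (nat list \<Rightarrow> nat \<Rightarrow> real) \<Rightarrow> (nat \<Rightarrow> nat) \<Rightarrow> real" where
  "sojourn_weight M v l = (\<Prod>k=1..M. v (history l k) (l k))"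

definition parameter_weight :: "nat \<Rightarrow> (nat \<Rightarrow> nat \<Rightarrow> real) \<Rightarrow> (nat \<Rightarrow> nat) \<Rightarrow> real" where
  "parameter_weight M w n = (\<Prod>j=0..M. w j (n j))"

definition parameters :: "(nat \<Rightarrow> nat \<Rightarrow> real) \<Rightarrow> (nat \<Rightarrow> nat) \<Rightarrow> nat \<Rightarrow> real" where
  "parameters \<theta> n j = \<theta> j (n j)"

definition mixture ::
  "nat \<Rightarrow> (nat \<Rightarrow> nat) \<Rightarrow> (nat \<Rightarrow> nat) \<Rightarrow> (nat list \<Rightarrow> nat \<Rightarrow> real) \<Rightarrow> (nat list \<Rightarrow> nat \<Rightarrow> real) \<Rightarrow>
   (nat \<Rightarrow> nat \<Rightarrow> real) \<Rightarrow> (nat \<Rightarrow> nat \<Rightarrow> real) \<Rightarrow> ((nat \<Rightarrow> real) \<Rightarrow> (nat \<Rightarrow> real) \<Rightarrow> real) \<Rightarrow> real" where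
  "mixture M L N z v \<theta> w g =
     (\<Sum>l\<in>sojourn_indices M L. \<Sum>n\<in>parameter_indices M N.
        sojourn_weight M v l * parameter_weight M w n * g (sojourn_times z l) (parameters \<theta> n))"


section \<open>The local volatility process\<close>

text \<open>\<open>f z \<theta> t x\<close> stands for the value at \<open>x\<close> of the density of the composite process at time \<open>t\<close>
  with sojourn times \<open>z\<close> and parameters \<open>\<theta>\<close>.  Where the mixture density vanishes both
  coefficients are 0 (division by zero); the diffusion coefficient is the nonnegative root.\<close>

definition lv_drift ::
  "nat \<Rightarrow> (nat \<Rightarrow> nat) \<Rightarrow> (nat \<Rightarrow> nat) \<Rightarrow> (nat list \<Rightarrow> nat \<Rightarrow> real) \<Rightarrow> (nat list \<Rightarrow> nat \<Rightarrow> real) \<Rightarrow>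
   (nat \<Rightarrow> nat \<Rightarrow> real) \<Rightarrow> (nat \<Rightarrow> nat \<Rightarrow> real) \<Rightarrow> (nat \<Rightarrow> real \<Rightarrow> real \<Rightarrow> real) \<Rightarrow>
   ((nat \<Rightarrow> real) \<Rightarrow> (nat \<Rightarrow> real) \<Rightarrow> real \<Rightarrow> real \<Rightarrow> real) \<Rightarrow> real \<Rightarrow> real \<Rightarrow> real" where
  "lv_drift M L N z v \<theta> w b f t x =
     mixture M L N z v \<theta> w (\<lambda>z' \<theta>'. composite_coefficient M b t z' \<theta>' * f z' \<theta>' t x)
       / mixture M L N z v \<theta> w (\<lambda>z' \<theta>'. f z' \<theta>' t x)"

definition lv_volatility ::
  "nat \<Rightarrow> (nat \<Rightarrow> nat) \<Rightarrow> (nat \<Rightarrow> nat) \<Rightarrow> (nat list \<Rightarrow> nat \<Rightarrow> real) \<Rightarrow> (nat list \<Rightarrow> nat \<Rightarrow> real) \<Rightarrow>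
   (nat \<Rightarrow> nat \<Rightarrow> real) \<Rightarrow> (nat \<Rightarrow> nat \<Rightarrow> real) \<Rightarrow> (nat \<Rightarrow> real \<Rightarrow> real \<Rightarrow> real) \<Rightarrow>
   ((nat \<Rightarrow> real) \<Rightarrow> (nat \<Rightarrow> real) \<Rightarrow> real \<Rightarrow> real \<Rightarrow> real) \<Rightarrow> real \<Rightarrow> real \<Rightarrow> real" where
  "lv_volatility M L N z v \<theta> w \<sigma> f t x =
     sqrt (mixture M L N z v \<theta> w (\<lambda>z' \<theta>'. (composite_coefficient M \<sigma> t z' \<theta>')\<^sup>2 * f z' \<theta>' t x)
       / mixture M L N z v \<theta> w (\<lambda>z' \<theta>'. f z' \<theta>' t x))"

text \<open>Strong solution of \<open>dX = \<mu>(t, X) dt + \<sigma>(t, X) dW + \<eta> dN\<close>, \<open>X 0 = x0\<close>, where \<open>\<eta> i\<close> is the size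
  of the jump at the \<open>i\<close>-th jump time of \<open>N\<close>.  It is adapted to the augmented filtration of \<open>W\<close>
  and of the marked point process, i.e. of \<open>N\<close> together with the compound process.\<close>

definition strong_solution ::
  "'a measure \<Rightarrow> real \<Rightarrow> (real \<Rightarrow> real) \<Rightarrow> (real \<Rightarrow> real \<Rightarrow> real) \<Rightarrow> (real \<Rightarrow> real \<Rightarrow> real) \<Rightarrow> real \<Rightarrow>
   (real \<Rightarrow> 'a \<Rightarrow> real) \<Rightarrow> (real \<Rightarrow> 'a \<Rightarrow> nat) \<Rightarrow> (nat \<Rightarrow> 'a \<Rightarrow> real) \<Rightarrow> (real \<Rightarrow> 'a \<Rightarrow> real) \<Rightarrow> bool" where
  "strong_solution \<Omega> lam F \<mu> \<sigma> x0 W N \<eta> X \<longleftrightarrow>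
     driving_noise \<Omega> {()} lam F (\<lambda>_. W) (\<lambda>_. N) (\<lambda>_. \<eta>) \<and>
     (let \<F> = augmented_filtration \<Omega>
                {W, (\<lambda>t \<omega>. real (N t \<omega>)), (\<lambda>t \<omega>. \<Sum>i=1..N t \<omega>. \<eta> i \<omega>)}
      in (\<forall>t\<ge>0. X t \<in> borel_measurable (\<F> t)) \<and>
         (AE \<omega> in \<Omega>. X 0 \<omega> = x0) \<and>
         (\<exists>I. ito_integral \<Omega> \<F> W (\<lambda>s \<omega>. \<sigma> s (X s \<omega>)) I \<and>
            (AE \<omega> in \<Omega>. \<forall>t\<ge>0.
               set_integrable lborel {0..t} (\<lambda>s. \<mu> s (X s \<omega>)) \<and>
               X t \<omega> = x0 + (LINT s:{0..t}|lborel. \<mu> s (X s \<omega>)) + I t \<omega> + (\<Sum>i=1..N t \<omega>. \<eta> i \<omega>))))"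

end

theory Submission
  imports Defs
begin

text \<open>The law of \<open>X' t\<close> is a finite mixture of the laws of the composite processes, so its
  characteristic function is the corresponding mixture of characteristic functions.  Each of those
  factors over the components: \<open>Y j\<close> at a fixed time agrees almost surely with a variable
  measurable with respect to the \<open>\<sigma>\<close>-algebra generated by the \<open>j\<close>-th noise alone, because the
  stochastic integral is a limit in probability, hence along a subsequence almost surely, of
  elementary integrals.  Distributivity of products over sums does the rest.  At time 0, where
  there is no density, both sides equal \<open>iexp (u * x0)\<close>, as the weights sum to 1.\<close>

section \<open>Characteristic functions of mixtures\<close>

lemma
  fixes f :: "real \<Rightarrow> real"
  assumes "prob_space M" and X: "distributed M lborel X (\<lambda>x. ennreal (f x))"
    and nonneg: "\<And>x. 0 \<le> f x"
  shows char_distributed: "char (distr M borel X) u = (LINT x|lborel. f x *\<^sub>R iexp (u * x))"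
    and integrable_density_iexp: "integrable lborel (\<lambda>x. f x *\<^sub>R iexp (u * x))"
proof -
  interpret prob_space M by fact
  have [measurable]: "f \<in> borel_measurable lborel"
    using distributed_real_measurable[OF nonneg X] .
  have eq: "distr M borel X = density lborel (\<lambda>x. ennreal (f x))"
    using distributed_distr_eq_density[OF X] by (metis distr_cong sets_lborel)
  have [measurable]: "X \<in> borel_measurable M"
    using distributed_measurable[OF X] by simp
  interpret D: prob_space "density lborel (\<lambda>x. ennreal (f x))"
    unfolding eq[symmetric] by (rule prob_space_distr) measurable
  have "integrable (density lborel (\<lambda>x. ennreal (f x))) (\<lambda>x. iexp (u * x))"
    by (rule D.integrable_const_bound[where B=1]) auto
  then show "integrable lborel (\<lambda>x. f x *\<^sub>R iexp (u * x))"
    using nonneg by (subst (asm) integrable_density) auto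
  show "char (distr M borel X) u = (LINT x|lborel. f x *\<^sub>R iexp (u * x))"
    unfolding char_def eq using nonneg by (subst integral_density) auto
qed

lemma char_finite_mixture:
  fixes f :: "'i \<Rightarrow> real \<Rightarrow> real"
  assumes "prob_space M" "prob_space M'"
    and c: "\<And>i. i \<in> A \<Longrightarrow> 0 \<le> c i" and f: "\<And>i x. i \<in> A \<Longrightarrow> 0 \<le> f i x"
    and Y: "\<And>i. i \<in> A \<Longrightarrow> distributed M lborel (Y i) (\<lambda>x. ennreal (f i x))"
    and X: "distributed M' lborel X (\<lambda>x. ennreal (\<Sum>i\<in>A. c i * f i x))"
  shows "char (distr M' borel X) u = (\<Sum>i\<in>A. complex_of_real (c i) * char (distr M borel (Y i)) u)"
proof -
  have "char (distr M' borel X) u = (LINT x|lborel. (\<Sum>i\<in>A. c i * f i x) *\<^sub>R iexp (u * x))"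
    using c f by (intro char_distributed[OF assms(2) X] sum_nonneg) auto
  also have "\<dots> = (LINT x|lborel. (\<Sum>i\<in>A. complex_of_real (c i) * (f i x *\<^sub>R iexp (u * x))))"
    by (simp add: scaleR_conv_of_real sum_distrib_right mult.assoc)
  also have "\<dots> = (\<Sum>i\<in>A. LINT x|lborel. complex_of_real (c i) * (f i x *\<^sub>R iexp (u * x)))"
    using integrable_density_iexp[OF assms(1) Y f]
    by (intro Bochner_Integration.integral_sum integrable_mult_right) auto
  also have "\<dots> = (\<Sum>i\<in>A. complex_of_real (c i) * char (distr M borel (Y i)) u)"
    by (intro sum.cong refl)
      (simp only: char_distributed[OF assms(1) Y f] integral_mult_right_zero)
  finally show ?thesis .
qed

section \<open>Limits in probability\<close>

lemma (in prob_space) limit_in_probability_measurable: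
  fixes X :: "nat \<Rightarrow> 'a \<Rightarrow> real"
  assumes sub: "subalgebra M G"
    and X: "\<And>k. X k \<in> borel_measurable G" and I: "I \<in> borel_measurable M"
    and lim: "\<And>\<epsilon>. 0 < \<epsilon> \<Longrightarrow> (\<lambda>k. prob {\<omega> \<in> space M. \<epsilon> < \<bar>X k \<omega> - I \<omega>\<bar>}) \<longlonglongrightarrow> 0"
  obtains J where "J \<in> borel_measurable G" "AE \<omega> in M. I \<omega> = J \<omega>"
proof -
  have [measurable]: "X k \<in> borel_measurable M" for k
    using measurable_from_subalg[OF sub X] .
  note I[measurable]
  have "\<exists>r. prob {\<omega> \<in> space M. (1/2)^k < \<bar>X r \<omega> - I \<omega>\<bar>} < (1/2)^k" for k
    using order_tendstoD(2)[OF lim[of "(1/2)^k"], of "(1/2)^k"]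
    by (auto simp: eventually_sequentially)
  then obtain r where r: "\<And>k. prob {\<omega> \<in> space M. (1/2)^k < \<bar>X (r k) \<omega> - I \<omega>\<bar>} < (1/2)^k"
    by metis
  have summ: "summable (\<lambda>k. prob {\<omega> \<in> space M. (1/2)^k < \<bar>X (r k) \<omega> - I \<omega>\<bar>})"
    by (rule summable_comparison_test'[OF summable_geometric[of "1/2 :: real"]])
       (use r in \<open>auto intro: less_imp_le\<close>)
  have "AE \<omega> in M. eventually (\<lambda>k. \<omega> \<in> space M - {\<omega> \<in> space M. (1/2)^k < \<bar>X (r k) \<omega> - I \<omega>\<bar>})
          sequentially"
    by (rule borel_cantelli_AE1[OF _ _ summ]) (auto simp: emeasure_eq_measure)
  then have "AE \<omega> in M. I \<omega> = lim (\<lambda>k. X (r k) \<omega>)"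
  proof eventually_elim
    case (elim \<omega>)
    have "(\<lambda>k. X (r k) \<omega> - I \<omega>) \<longlonglongrightarrow> 0"
    proof (rule Lim_null_comparison)
      show "\<forall>\<^sub>F k in sequentially. norm (X (r k) \<omega> - I \<omega>) \<le> (1/2)^k"
        using elim by eventually_elim auto
      show "(\<lambda>k. (1/2)^k :: real) \<longlonglongrightarrow> 0"
        by (rule LIMSEQ_realpow_zero) auto
    qed
    then show ?case
      by (simp add: LIM_zero_iff limI)
  qed
  moreover have "(\<lambda>\<omega>. lim (\<lambda>k. X (r k) \<omega>)) \<in> borel_measurable G"
    using X by measurable
  ultimately show ?thesis
    using that by blast
qed

section \<open>The component processes\<close>

lemma elementary_integrand_nonneg:
  assumes "elementary_integrand \<Omega> F n p \<xi>" "i \<le> n"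
  shows "0 \<le> p i"
  using assms(2)
proof (induction i)
  case 0
  then show ?case using assms(1) by (simp add: elementary_integrand_def)
next
  case (Suc i)
  then have "0 \<le> p i" "p i \<le> p (Suc i)"
    using assms(1) by (simp_all add: elementary_integrand_def)
  then show ?case by (rule order_trans)
qed

lemma subalgebra_natural_filtration:
  assumes X: "\<And>X s. X \<in> XS \<Longrightarrow> 0 \<le> s \<Longrightarrow> X s \<in> borel_measurable G" and space: "space G = space \<Omega>"
  shows "subalgebra G (natural_filtration \<Omega> XS t)"
proof -
  let ?A = "{X s -` A \<inter> space \<Omega> | X s A. X \<in> XS \<and> 0 \<le> s \<and> s \<le> t \<and> A \<in> sets borel}"
  have "?A \<subseteq> sets G"
    using measurable_sets[OF X] unfolding space by blast
  then have "sigma_sets (space \<Omega>) ?A \<subseteq> sets G"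
    unfolding space[symmetric] by (rule sets.sigma_sets_subset)
  moreover have "?A \<subseteq> Pow (space \<Omega>)"
    by blast
  ultimately show ?thesis
    by (simp add: subalgebra_def natural_filtration_def space sets_measure_of space_measure_of)
qed

lemma ito_integral_measurable:
  assumes "prob_space \<Omega>" and sub: "subalgebra \<Omega> G"
    and W: "\<And>s. 0 \<le> s \<Longrightarrow> W s \<in> borel_measurable G"
    and ito: "ito_integral \<Omega> (natural_filtration \<Omega> {W}) W H I" and "0 \<le> t"
  obtains J where "J \<in> borel_measurable G" "AE \<omega> in \<Omega>. I t \<omega> = J \<omega>"
proof -
  interpret prob_space \<Omega> by fact
  obtain n p \<xi> where
    elem: "\<And>k::nat. elementary_integrand \<Omega> (natural_filtration \<Omega> {W}) (n k) (p k) (\<xi> k)"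
    and lim: "\<And>\<epsilon>. 0 < \<epsilon> \<Longrightarrow> (\<lambda>k. prob {\<omega> \<in> space \<Omega>.
        \<epsilon> < \<bar>elementary_integral W (n k) (p k) (\<xi> k) t \<omega> - I t \<omega>\<bar>}) \<longlonglongrightarrow> 0"
    using ito \<open>0 \<le> t\<close> unfolding ito_integral_def by blast
  have space: "space G = space \<Omega>"
    using sub by (simp add: subalgebra_def)
  have \<xi>: "\<xi> k i \<in> borel_measurable G" if "i < n k" for k i
  proof (rule measurable_from_subalg)
    show "subalgebra G (natural_filtration \<Omega> {W} (p k i))"
      using W space by (intro subalgebra_natural_filtration) auto
    show "\<xi> k i \<in> borel_measurable (natural_filtration \<Omega> {W} (p k i))"
      using elem[of k] that by (simp add: elementary_integrand_def)
  qed
  have "elementary_integral W (n k) (p k) (\<xi> k) t \<in> borel_measurable G" for k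
    unfolding elementary_integral_def [abs_def]
  proof (rule borel_measurable_sum)
    fix i assume "i \<in> {..<n k}"
    then have i: "i < n k" by simp
    then have "0 \<le> p k i" "0 \<le> p k (Suc i)"
      using elementary_integrand_nonneg[OF elem[of k]] by auto
    then have [measurable]: "W (min t (p k (Suc i))) \<in> borel_measurable G"
        "W (min t (p k i)) \<in> borel_measurable G"
      using \<open>0 \<le> t\<close> by (auto intro!: W)
    note \<xi>[OF i, measurable]
    show "(\<lambda>\<omega>. \<xi> k i \<omega> * (W (min t (p k (Suc i))) \<omega> - W (min t (p k i)) \<omega>)) \<in> borel_measurable G"
      by measurable
  qed
  then show ?thesis
    using limit_in_probability_measurable[OF sub _ _ lim] that ito \<open>0 \<le> t\<close>
    unfolding ito_integral_def by blast
qed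

lemma borel_measurable_random_sum:
  fixes \<eta> :: "nat \<Rightarrow> 'a \<Rightarrow> real"
  assumes "N \<in> measurable G (count_space UNIV)" and "\<And>i. 1 \<le> i \<Longrightarrow> \<eta> i \<in> borel_measurable G"
  shows "(\<lambda>\<omega>. \<Sum>i=1..N \<omega>. \<eta> i \<omega>) \<in> borel_measurable G"
proof (rule measurable_compose_countable[where f = "\<lambda>n \<omega>. \<Sum>i=1..n. \<eta> i \<omega>"])
  show "(\<lambda>\<omega>. \<Sum>i=1..n. \<eta> i \<omega>) \<in> borel_measurable G" for n :: nat
    using assms(2) by (intro borel_measurable_sum) simp
qed fact

lemma component_process_measurable:
  assumes "prob_space \<Omega>" and sub: "subalgebra \<Omega> G"
    and W: "\<And>s. 0 \<le> s \<Longrightarrow> W s \<in> borel_measurable G"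
    and P: "P t \<in> measurable G (count_space UNIV)"
    and \<eta>: "\<And>i. 1 \<le> i \<Longrightarrow> \<eta> i \<in> borel_measurable G"
    and comp: "component_process \<Omega> b \<sigma> W P \<eta> q Y" and "0 \<le> t"
  obtains Z where "Z \<in> borel_measurable G" "AE \<omega> in \<Omega>. Y t \<omega> = Z \<omega>"
proof -
  obtain I where ito: "ito_integral \<Omega> (natural_filtration \<Omega> {W}) W (\<lambda>u _. \<sigma> u q) I"
    and Y: "AE \<omega> in \<Omega>. \<forall>t\<ge>0.
      Y t \<omega> = (LINT u:{0..t}|lborel. b u q) + I t \<omega> + (\<Sum>i=1..P t \<omega>. \<eta> i \<omega>)"
    using comp unfolding component_process_def by blast
  obtain J where [measurable]: "J \<in> borel_measurable G" and J: "AE \<omega> in \<Omega>. I t \<omega> = J \<omega>"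
    using ito_integral_measurable[OF assms(1) sub W ito \<open>0 \<le> t\<close>] by blast
  have [measurable]: "(\<lambda>\<omega>. \<Sum>i=1..P t \<omega>. \<eta> i \<omega>) \<in> borel_measurable G"
    by (rule borel_measurable_random_sum[OF P \<eta>])
  have "(\<lambda>\<omega>. (LINT u:{0..t}|lborel. b u q) + J \<omega> + (\<Sum>i=1..P t \<omega>. \<eta> i \<omega>)) \<in> borel_measurable G"
    by measurable
  moreover have "AE \<omega> in \<Omega>. Y t \<omega> =
      (LINT u:{0..t}|lborel. b u q) + J \<omega> + (\<Sum>i=1..P t \<omega>. \<eta> i \<omega>)"
    using Y J by eventually_elim (use \<open>0 \<le> t\<close> in auto)
  ultimately show ?thesis
    using that by blast
qed

lemma component_process_0:
  assumes "prob_space \<Omega>" and P: "AE \<omega> in \<Omega>. P 0 \<omega> = 0"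
    and comp: "component_process \<Omega> b \<sigma> W P \<eta> q Y"
  shows "AE \<omega> in \<Omega>. Y 0 \<omega> = 0"
proof -
  interpret prob_space \<Omega> by fact
  obtain I where ito: "ito_integral \<Omega> (natural_filtration \<Omega> {W}) W (\<lambda>u _. \<sigma> u q) I"
    and Y: "AE \<omega> in \<Omega>. \<forall>t\<ge>0.
      Y t \<omega> = (LINT u:{0..t}|lborel. b u q) + I t \<omega> + (\<Sum>i=1..P t \<omega>. \<eta> i \<omega>)"
    using comp unfolding component_process_def by blast
  obtain n p \<xi> where
    elem: "\<And>k::nat. elementary_integrand \<Omega> (natural_filtration \<Omega> {W}) (n k) (p k) (\<xi> k)"
    and lim: "\<And>\<epsilon>. 0 < \<epsilon> \<Longrightarrow> (\<lambda>k. prob {\<omega> \<in> space \<Omega>.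
        \<epsilon> < \<bar>elementary_integral W (n k) (p k) (\<xi> k) 0 \<omega> - I 0 \<omega>\<bar>}) \<longlonglongrightarrow> 0"
    using ito unfolding ito_integral_def by blast
  have [measurable]: "I 0 \<in> borel_measurable \<Omega>"
    using ito by (simp add: ito_integral_def)
  have zero: "elementary_integral W (n k) (p k) (\<xi> k) 0 \<omega> = 0" for k \<omega>
    unfolding elementary_integral_def
    by (rule sum.neutral) (simp add: elementary_integrand_nonneg[OF elem] min_absorb1)
  have "AE \<omega> in \<Omega>. \<bar>I 0 \<omega>\<bar> \<le> inverse (Suc m)" for m
  proof -
    have "prob {\<omega> \<in> space \<Omega>. inverse (Suc m) < \<bar>I 0 \<omega>\<bar>} = 0"
      using lim[of "inverse (Suc m)"] by (simp add: zero LIMSEQ_const_iff)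
    then have "AE \<omega> in \<Omega>. \<not> inverse (Suc m) < \<bar>I 0 \<omega>\<bar>"
      by (subst (asm) prob_Collect_eq_0) measurable
    then show ?thesis
      by (simp add: not_less)
  qed
  then have "AE \<omega> in \<Omega>. \<forall>m. \<bar>I 0 \<omega>\<bar> \<le> inverse (Suc m)"
    by (simp add: AE_all_countable)
  then have "AE \<omega> in \<Omega>. I 0 \<omega> = 0"
  proof eventually_elim
    case (elim \<omega>)
    then show ?case
      by (metis linorder_not_less reals_Archimedean zero_less_abs_iff)
  qed
  with Y P show ?thesis
  proof eventually_elim
    case (elim \<omega>)
    have "(LINT u:{0..0}|lborel. b u q) = 0"
      unfolding set_lebesgue_integral_def
      by (rule integral_eq_zero_AE, rule AE_I'[of "{0}"]) (auto simp: null_sets_def split: split_indicator_asm)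
    with elim show ?case by simp
  qed
qed

definition source_algebra ::
  "'a measure \<Rightarrow> ('j \<Rightarrow> real \<Rightarrow> 'a \<Rightarrow> real) \<Rightarrow> ('j \<Rightarrow> real \<Rightarrow> 'a \<Rightarrow> nat) \<Rightarrow> ('j \<Rightarrow> nat \<Rightarrow> 'a \<Rightarrow> real) \<Rightarrow>
   'j \<Rightarrow> 'a measure" where
  "source_algebra \<Omega> W P \<eta> j =
     sigma (space \<Omega>)
       (\<Union>s\<in>{Brownian j, Poisson j} \<union> Jump j ` {1..}. source_events \<Omega> W P \<eta> s)"

lemma source_events_subset: "source_events \<Omega> W P \<eta> s \<subseteq> Pow (space \<Omega>)"
  by (cases s) (auto dest: sigma_sets_into_sp[rotated])

lemma sets_source_algebra:
  "sets (source_algebra \<Omega> W P \<eta> j) = sigma_sets (space \<Omega>)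
     (\<Union>s\<in>{Brownian j, Poisson j} \<union> Jump j ` {1..}. source_events \<Omega> W P \<eta> s)"
  unfolding source_algebra_def
  by (rule sets_measure_of) (use source_events_subset[of \<Omega> W P \<eta>] in blast)

lemma space_source_algebra [simp]: "space (source_algebra \<Omega> W P \<eta> j) = space \<Omega>"
  unfolding source_algebra_def
  by (rule space_measure_of) (use source_events_subset[of \<Omega> W P \<eta>] in blast)

lemma Int_stable_sigma_sets: "A \<subseteq> Pow S \<Longrightarrow> Int_stable (sigma_sets S A)"
  by (intro Int_stableI) (metis sets.Int sets_measure_of)

lemma Int_stable_source_events: "Int_stable (source_events \<Omega> W P \<eta> s)"
proof (cases s)
  case (Jump j i)
  have "\<exists>C. (\<eta> j i -` A \<inter> space \<Omega>) \<inter> (\<eta> j i -` B \<inter> space \<Omega>) = \<eta> j i -` C \<inter> space \<Omega> \<and> C \<in> sets borel"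
    if "A \<in> sets borel" "B \<in> sets borel" for A B
    using that by (intro exI[of _ "A \<inter> B"]) auto
  then show ?thesis
    unfolding Jump by (auto simp: Int_stable_def)
qed (auto intro!: Int_stable_sigma_sets)

lemma source_algebra_measurable:
  assumes "0 \<le> s"
  shows "W j s \<in> borel_measurable (source_algebra \<Omega> W P \<eta> j)"
    and "P j s \<in> measurable (source_algebra \<Omega> W P \<eta> j) (count_space UNIV)"
proof -
  show "W j s \<in> borel_measurable (source_algebra \<Omega> W P \<eta> j)"
  proof (rule measurableI)
    fix A :: "real set" assume "A \<in> sets borel"
    then have "W j s -` A \<inter> space \<Omega> \<in> source_events \<Omega> W P \<eta> (Brownian j)"
      using assms by (auto intro!: sigma_sets.Basic)
    then show "W j s -` A \<inter> space (source_algebra \<Omega> W P \<eta> j) \<in> sets (source_algebra \<Omega> W P \<eta> j)"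
      unfolding sets_source_algebra by (auto intro!: sigma_sets.Basic simp del: source_events.simps)
  qed simp
  show "P j s \<in> measurable (source_algebra \<Omega> W P \<eta> j) (count_space UNIV)"
  proof (rule measurableI)
    fix A :: "nat set"
    have "P j s -` A \<inter> space \<Omega> \<in> source_events \<Omega> W P \<eta> (Poisson j)"
      using assms by (auto intro!: sigma_sets.Basic)
    then show "P j s -` A \<inter> space (source_algebra \<Omega> W P \<eta> j) \<in> sets (source_algebra \<Omega> W P \<eta> j)"
      unfolding sets_source_algebra by (auto intro!: sigma_sets.Basic simp del: source_events.simps)
  qed simp
qed

lemma source_algebra_measurable_jump:
  assumes "1 \<le> i"
  shows "\<eta> j i \<in> borel_measurable (source_algebra \<Omega> W P \<eta> j)"
proof (rule measurableI)
  fix A :: "real set" assume "A \<in> sets borel"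
  then have "\<eta> j i -` A \<inter> space \<Omega> \<in> source_events \<Omega> W P \<eta> (Jump j i)"
    by auto
  then show "\<eta> j i -` A \<inter> space (source_algebra \<Omega> W P \<eta> j) \<in> sets (source_algebra \<Omega> W P \<eta> j)"
    unfolding sets_source_algebra using assms
    by (auto intro!: sigma_sets.Basic simp del: source_events.simps)
qed simp

lemma indep_source_algebras:
  assumes "prob_space \<Omega>" and "driving_noise \<Omega> J lam F W P \<eta>"
  shows "prob_space.indep_sets \<Omega> (\<lambda>j. sets (source_algebra \<Omega> W P \<eta> j)) J"
proof -
  interpret prob_space \<Omega> by fact
  have "(\<Union>j\<in>J. {Brownian j, Poisson j} \<union> Jump j ` {1..}) =
      Brownian ` J \<union> Poisson ` J \<union> {Jump j i | j i. j \<in> J \<and> 1 \<le> i}"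
    by auto
  then have "indep_sets (source_events \<Omega> W P \<eta>)
      (\<Union>j\<in>J. {Brownian j, Poisson j} \<union> Jump j ` {1..})"
    using assms(2) by (simp add: driving_noise_def)
  then show ?thesis
    unfolding sets_source_algebra
    by (rule indep_sets_collect_sigma) (auto simp: Int_stable_source_events disjoint_family_on_def)
qed

lemma char_sum_components:
  assumes "prob_space \<Omega>" and noise: "driving_noise \<Omega> J lam F W P \<eta>"
    and comp: "\<And>j. j \<in> J \<Longrightarrow> component_process \<Omega> (b j) (\<sigma> j) (W j) (P j) (\<eta> j) (q j) (Y j)"
    and s: "\<And>j. j \<in> J \<Longrightarrow> 0 \<le> s j"
  shows "char (distr \<Omega> borel (\<lambda>\<omega>. \<Sum>j\<in>J. Y j (s j) \<omega>)) u
    = (\<Prod>j\<in>J. char (distr \<Omega> borel (Y j (s j))) u)"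
proof (cases "finite J")
  case True
  interpret prob_space \<Omega> by fact
  let ?G = "source_algebra \<Omega> W P \<eta>"
  note indep = indep_source_algebras[OF assms(1) noise]
  have sub: "subalgebra \<Omega> (?G j)" if "j \<in> J" for j
    using indep that by (auto simp: subalgebra_def indep_sets_def)
  have "\<exists>Z. Z \<in> borel_measurable (?G j) \<and> (AE \<omega> in \<Omega>. Y j (s j) \<omega> = Z \<omega>)" if "j \<in> J" for j
    using component_process_measurable[OF assms(1) sub[OF that] source_algebra_measurable(1)
        source_algebra_measurable(2)[OF s[OF that]] source_algebra_measurable_jump
        comp[OF that] s[OF that]] by metis
  then obtain Z where ZG: "\<And>j. j \<in> J \<Longrightarrow> Z j \<in> borel_measurable (?G j)"
    and Z: "\<And>j. j \<in> J \<Longrightarrow> AE \<omega> in \<Omega>. Y j (s j) \<omega> = Z j \<omega>"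
    by metis
  have Zm: "Z j \<in> borel_measurable \<Omega>" if "j \<in> J" for j
    using measurable_from_subalg[OF sub ZG] that by blast
  have Ym: "Y j (s j) \<in> borel_measurable \<Omega>" if "j \<in> J" for j
    using comp[OF that] s[OF that] by (simp add: component_process_def)
  have "indep_vars (\<lambda>_. borel) Z J"
    unfolding indep_vars_def2
  proof (intro conjI ballI Zm)
    show "indep_sets (\<lambda>j. {Z j -` A \<inter> space \<Omega> |A. A \<in> sets borel}) J"
      by (rule indep_sets_mono_sets[OF indep]) (use measurable_sets[OF ZG] in auto)
  qed
  from char_distr_sum[OF this]
  have "char (distr \<Omega> borel (\<lambda>\<omega>. \<Sum>j\<in>J. Z j \<omega>)) u = (\<Prod>j\<in>J. char (distr \<Omega> borel (Z j)) u)" .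
  moreover have "distr \<Omega> borel (Y j (s j)) = distr \<Omega> borel (Z j)" if "j \<in> J" for j
    using that by (intro distr_cong_AE Z Ym Zm) auto
  moreover have "distr \<Omega> borel (\<lambda>\<omega>. \<Sum>j\<in>J. Y j (s j) \<omega>) = distr \<Omega> borel (\<lambda>\<omega>. \<Sum>j\<in>J. Z j \<omega>)"
  proof (intro distr_cong_AE borel_measurable_sum Ym Zm)
    have "AE \<omega> in \<Omega>. \<forall>j\<in>J. Y j (s j) \<omega> = Z j \<omega>"
      using Z True by (simp add: AE_finite_all)
    then show "AE \<omega> in \<Omega>. (\<Sum>j\<in>J. Y j (s j) \<omega>) = (\<Sum>j\<in>J. Z j \<omega>)"
      by eventually_elim (rule sum.cong, auto)
  qed auto
  ultimately show ?thesis by simp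
next
  case False
  interpret prob_space \<Omega> by fact
  show ?thesis
    using False by (simp add: char_def integral_distr prob_space del: distr_const)
qed

lemma char_add_const:
  assumes X: "X \<in> borel_measurable M"
  shows "char (distr M borel (\<lambda>\<omega>. c + X \<omega>)) u = iexp (u * c) * char (distr M borel X) u"
  using X by (simp add: char_def integral_distr distrib_left exp_add)

lemma char_AE_const:
  assumes "prob_space M" "X \<in> borel_measurable M" "AE \<omega> in M. X \<omega> = c"
  shows "char (distr M borel X) u = iexp (u * c)"
proof -
  interpret prob_space M by fact
  have "distr M borel X = distr M borel (\<lambda>_. c)"
    using assms by (intro distr_cong_AE) auto
  then show ?thesis
    by (simp add: char_def integral_distr prob_space del: distr_const)
qed

lemma local_time_bounds:
  assumes z: "\<And>k. k \<in> {1..M} \<Longrightarrow> 0 < z k" and "j \<le> M" "0 \<le> t"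
  shows "0 \<le> local_time M z j t" "local_time M z j t \<le> t"
proof -
  have "0 \<le> switch_time z j"
    unfolding switch_time_def using assms(2) by (intro sum_nonneg less_imp_le z) auto
  moreover have "j < M \<Longrightarrow> switch_time z j \<le> switch_time z (Suc j)"
    using z[of "Suc j"] by (simp add: switch_time_def)
  ultimately show "0 \<le> local_time M z j t" "local_time M z j t \<le> t"
    using \<open>0 \<le> t\<close> by (auto simp: local_time_def)
qed

section \<open>The local volatility process\<close>

lemma subalgebra_augmented_filtration:
  assumes X: "\<And>X s. X \<in> XS \<Longrightarrow> 0 \<le> s \<Longrightarrow> X s \<in> borel_measurable \<Omega>"
  shows "subalgebra \<Omega> (augmented_filtration \<Omega> XS t)"
proof -
  let ?N = "natural_filtration \<Omega> XS t"
  have "sets ?N \<subseteq> sets \<Omega>"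
    using subalgebra_natural_filtration[of XS \<Omega> \<Omega> t] X by (simp add: subalgebra_def)
  then have "sets ?N \<union> null_sets \<Omega> \<subseteq> sets \<Omega>" by auto
  moreover from this have "sets ?N \<union> null_sets \<Omega> \<subseteq> Pow (space \<Omega>)"
    using sets.space_closed by blast
  ultimately show ?thesis
    by (simp add: subalgebra_def augmented_filtration_def space_measure_of sets.sigma_sets_subset)
qed

lemma strong_solution_measurable:
  assumes sol: "strong_solution \<Omega> lam F \<mu> \<sigma> x0 W N \<eta> X" and "0 \<le> t"
  shows "X t \<in> borel_measurable \<Omega>"
proof -
  have noise: "driving_noise \<Omega> {()} lam F (\<lambda>_. W) (\<lambda>_. N) (\<lambda>_. \<eta>)"
    using sol by (simp add: strong_solution_def)
  have W: "W s \<in> borel_measurable \<Omega>" and N: "N s \<in> measurable \<Omega> (count_space UNIV)" if "0 \<le> s" for s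
    using noise that by (auto simp: driving_noise_def brownian_motion_def poisson_process_def)
  have \<eta>: "\<eta> i \<in> borel_measurable \<Omega>" if "1 \<le> i" for i
    using noise that by (auto simp: driving_noise_def)
  have "(\<lambda>\<omega>. \<Sum>i=1..N s \<omega>. \<eta> i \<omega>) \<in> borel_measurable \<Omega>" if "0 \<le> s" for s
    by (rule borel_measurable_random_sum[OF N[OF that] \<eta>])
  moreover have "(\<lambda>\<omega>. real (N s \<omega>)) \<in> borel_measurable \<Omega>" if "0 \<le> s" for s
    using N[OF that] by measurable
  ultimately have "subalgebra \<Omega> (augmented_filtration \<Omega>
      {W, (\<lambda>t \<omega>. real (N t \<omega>)), (\<lambda>t \<omega>. \<Sum>i=1..N t \<omega>. \<eta> i \<omega>)} t)"
    using W by (intro subalgebra_augmented_filtration) auto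
  moreover have "X t \<in> borel_measurable (augmented_filtration \<Omega>
      {W, (\<lambda>t \<omega>. real (N t \<omega>)), (\<lambda>t \<omega>. \<Sum>i=1..N t \<omega>. \<eta> i \<omega>)} t)"
    using sol \<open>0 \<le> t\<close> by (simp add: strong_solution_def Let_def)
  ultimately show ?thesis
    by (rule measurable_from_subalg)
qed

theorem corollary4p3:
  fixes \<Omega> :: "'a measure" and \<Omega>' :: "'b measure"
    and M :: nat and x0 lam :: real and F :: "real \<Rightarrow> real"
    and W :: "nat \<Rightarrow> real \<Rightarrow> 'a \<Rightarrow> real"
    and P :: "nat \<Rightarrow> real \<Rightarrow> 'a \<Rightarrow> nat"
    and \<eta> :: "nat \<Rightarrow> nat \<Rightarrow> 'a \<Rightarrow> real"
    and b \<sigma> :: "nat \<Rightarrow> real \<Rightarrow> real \<Rightarrow> real"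
    and Y :: "nat \<Rightarrow> real \<Rightarrow> real \<Rightarrow> 'a \<Rightarrow> real"
    and N L :: "nat \<Rightarrow> nat"
    and \<theta> w :: "nat \<Rightarrow> nat \<Rightarrow> real"
    and z v :: "nat list \<Rightarrow> nat \<Rightarrow> real"
    and f :: "(nat \<Rightarrow> real) \<Rightarrow> (nat \<Rightarrow> real) \<Rightarrow> real \<Rightarrow> real \<Rightarrow> real"
    and W' :: "real \<Rightarrow> 'b \<Rightarrow> real"
    and N' :: "real \<Rightarrow> 'b \<Rightarrow> nat"
    and \<eta>' :: "nat \<Rightarrow> 'b \<Rightarrow> real"
    and X' :: "real \<Rightarrow> 'b \<Rightarrow> real"
  assumes prob_spaces: "prob_space \<Omega>" "prob_space \<Omega>'"
    and intensity: "0 \<le> lam"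
    and noise: "driving_noise \<Omega> {0..M} lam F W P \<eta>"
    and coefficients: "\<And>j. j \<le> M \<Longrightarrow> admissible_coefficients (b j) (\<sigma> j)"
    and components: "\<And>j q. j \<le> M \<Longrightarrow>
          component_process \<Omega> (b j) (\<sigma> j) (W j) (P j) (\<eta> j) q (Y j q)"
    and w_nonneg: "\<And>j n. j \<le> M \<Longrightarrow> n \<in> {1..N j} \<Longrightarrow> 0 \<le> w j n"
    and w_sum: "\<And>j. j \<le> M \<Longrightarrow> (\<Sum>n=1..N j. w j n) = 1"
    and z_pos: "\<And>k l. k \<in> {1..M} \<Longrightarrow> (\<And>i. i \<in> {1..k} \<Longrightarrow> l i \<in> {1..L i}) \<Longrightarrow>
          0 < z (history l k) (l k)"
    and v_pos: "\<And>k l. k \<in> {1..M} \<Longrightarrow> (\<And>i. i \<in> {1..k} \<Longrightarrow> l i \<in> {1..L i}) \<Longrightarrow>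
          0 < v (history l k) (l k)"
    and v_sum: "\<And>k l. k \<in> {1..M} \<Longrightarrow> (\<And>i. i \<in> {1..<k} \<Longrightarrow> l i \<in> {1..L i}) \<Longrightarrow>
          (\<Sum>m=1..L k. v (history l k) m) = 1"
    and f_nonneg: "\<And>z' \<theta>' t x. 0 \<le> f z' \<theta>' t x"
    and f_density: "\<And>l n t. l \<in> sojourn_indices M L \<Longrightarrow> n \<in> parameter_indices M N \<Longrightarrow> 0 < t \<Longrightarrow>
          distributed \<Omega> lborel
            (composite_process M x0 Y (sojourn_times z l) (parameters \<theta> n) t)
            (\<lambda>x. ennreal (f (sojourn_times z l) (parameters \<theta> n) t x))"
    and X'_solution: "strong_solution \<Omega>' lam F
          (lv_drift M L N z v \<theta> w b f) (lv_volatility M L N z v \<theta> w \<sigma> f) x0 W' N' \<eta>' X'"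
    and X'_density: "\<And>t. 0 < t \<Longrightarrow>
          distributed \<Omega>' lborel (X' t)
            (\<lambda>x. ennreal (mixture M L N z v \<theta> w (\<lambda>z' \<theta>'. f z' \<theta>' t x)))"
  shows "\<forall>u::real. \<forall>t\<ge>0.
    char (distr \<Omega>' borel (X' t)) u
      = iexp (u * x0) *
        (\<Sum>l\<in>sojourn_indices M L. complex_of_real (sojourn_weight M v l) *
           (\<Prod>j=0..M. \<Sum>n=1..N j. complex_of_real (w j n) *
              char (distr \<Omega> borel (Y j (\<theta> j n) (local_time M (sojourn_times z l) j t))) u))"
proof (intro allI impI)
  fix u t :: real assume t: "0 \<le> t"
  interpret A: prob_space \<Omega> by (rule prob_spaces)
  interpret B: prob_space \<Omega>' by (rule prob_spaces)
  let ?S = "sojourn_indices M L" and ?Q = "parameter_indices M N"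
  let ?z = "sojourn_times z" and ?V = "sojourn_weight M v"
  let ?\<phi> = "\<lambda>l j q t u. char (distr \<Omega> borel (Y j q (local_time M (?z l) j t))) u"
  have z_pos': "0 < ?z l k" if "l \<in> ?S" "k \<in> {1..M}" for l k
    unfolding sojourn_times_def using that
    by (intro z_pos) (auto simp: sojourn_indices_def PiE_def Pi_def)
  have V_nonneg: "0 \<le> ?V l" if "l \<in> ?S" for l
    unfolding sojourn_weight_def using that
    by (intro prod_nonneg ballI less_imp_le v_pos) (auto simp: sojourn_indices_def PiE_def Pi_def)
  have w_nonneg': "0 \<le> parameter_weight M w n" if "n \<in> ?Q" for n
    unfolding parameter_weight_def using that
    by (intro prod_nonneg ballI w_nonneg) (auto simp: parameter_indices_def PiE_def Pi_def)
  have Y_measurable: "Y j q s \<in> borel_measurable \<Omega>" if "j \<le> M" "0 \<le> s" for j q s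
    using components[OF that(1), of q] that(2) by (simp add: component_process_def)
  have composite: "char (distr \<Omega> borel (composite_process M x0 Y (?z l) q t)) u
      = iexp (u * x0) * (\<Prod>j=0..M. ?\<phi> l j (q j) t u)" if "l \<in> ?S" "0 \<le> t" for l q t u
  proof -
    have "(\<lambda>\<omega>. \<Sum>j=0..M. Y j (q j) (local_time M (?z l) j t) \<omega>) \<in> borel_measurable \<Omega>"
      using that z_pos' by (intro borel_measurable_sum Y_measurable local_time_bounds) auto
    moreover have "char (distr \<Omega> borel (\<lambda>\<omega>. \<Sum>j=0..M. Y j (q j) (local_time M (?z l) j t) \<omega>)) u
        = (\<Prod>j=0..M. ?\<phi> l j (q j) t u)"
      using that z_pos'
      by (intro char_sum_components[OF prob_spaces(1) noise, where b = b and \<sigma> = \<sigma> and q = q]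
            components local_time_bounds) auto
    ultimately show ?thesis
      unfolding composite_process_def [abs_def] by (simp only: char_add_const)
  qed
  have factor: "(\<Sum>n\<in>?Q. complex_of_real (parameter_weight M w n) * (\<Prod>j=0..M. g j (\<theta> j (n j))))
      = (\<Prod>j=0..M. \<Sum>n=1..N j. complex_of_real (w j n) * g j (\<theta> j n))"
    for g :: "nat \<Rightarrow> real \<Rightarrow> complex"
    unfolding parameter_indices_def parameter_weight_def
    by (subst prod_sum_PiE) (auto simp: prod.distrib)
  have pos: "char (distr \<Omega>' borel (X' t)) u = iexp (u * x0) *
      (\<Sum>l\<in>?S. complex_of_real (?V l) *
        (\<Prod>j=0..M. \<Sum>n=1..N j. complex_of_real (w j n) * ?\<phi> l j (\<theta> j n) t u))"
    if "0 < t" for t u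
  proof -
    have "distributed \<Omega>' lborel (X' t) (\<lambda>x. ennreal (\<Sum>i\<in>?S \<times> ?Q.
        (?V (fst i) * parameter_weight M w (snd i)) * f (?z (fst i)) (parameters \<theta> (snd i)) t x))"
      using X'_density[OF that] by (simp add: mixture_def sum.cartesian_product split_def)
    from char_finite_mixture[OF prob_spaces _ f_nonneg f_density this]
    have "char (distr \<Omega>' borel (X' t)) u = (\<Sum>i\<in>?S \<times> ?Q.
        complex_of_real (?V (fst i) * parameter_weight M w (snd i)) *
        char (distr \<Omega> borel (composite_process M x0 Y (?z (fst i)) (parameters \<theta> (snd i)) t)) u)"
      using that V_nonneg w_nonneg' by auto
    also have "\<dots> = (\<Sum>l\<in>?S. \<Sum>n\<in>?Q. complex_of_real (?V l * parameter_weight M w n) *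
        char (distr \<Omega> borel (composite_process M x0 Y (?z l) (parameters \<theta> n) t)) u)"
      by (simp add: sum.cartesian_product split_def)
    also have "\<dots> = (\<Sum>l\<in>?S. \<Sum>n\<in>?Q. iexp (u * x0) * (complex_of_real (?V l) *
        (complex_of_real (parameter_weight M w n) * (\<Prod>j=0..M. ?\<phi> l j (\<theta> j (n j)) t u))))"
      using that by (intro sum.cong refl) (simp add: composite parameters_def mult_ac)
    also have "\<dots> = iexp (u * x0) * (\<Sum>l\<in>?S. complex_of_real (?V l) *
        (\<Sum>n\<in>?Q. complex_of_real (parameter_weight M w n) * (\<Prod>j=0..M. ?\<phi> l j (\<theta> j (n j)) t u)))"
      by (simp only: sum_distrib_left)
    finally show ?thesis
      by (simp only: factor[of "\<lambda>j q. ?\<phi> l j q t u" for l])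
  qed
  have prod_w: "(\<Prod>j=0..M. \<Sum>n=1..N j. complex_of_real (w j n) * 1) = 1"
  proof (intro prod.neutral ballI)
    fix j assume "j \<in> {0..M}"
    then have "complex_of_real (\<Sum>n=1..N j. w j n) = 1"
      by (simp only: w_sum atLeastAtMost_iff of_real_1)
    then show "(\<Sum>n=1..N j. complex_of_real (w j n) * 1) = 1"
      by simp
  qed
  show "char (distr \<Omega>' borel (X' t)) u = iexp (u * x0) *
      (\<Sum>l\<in>?S. complex_of_real (?V l) *
        (\<Prod>j=0..M. \<Sum>n=1..N j. complex_of_real (w j n) * ?\<phi> l j (\<theta> j n) t u))"
  proof (cases "t = 0")
    case False
    with t show ?thesis by (intro pos) auto
  next
    case True
    have \<phi>1: "?\<phi> l j q s r = 1" if "l \<in> ?S" "j \<le> M" "s = 0 \<or> r = 0" "0 \<le> s" for l j q s r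
    proof (cases "r = 0")
      case True
      have "Y j q (local_time M (?z l) j s) \<in> borel_measurable \<Omega>"
        using that z_pos' by (intro Y_measurable local_time_bounds) auto
      then have "real_distribution (distr \<Omega> borel (Y j q (local_time M (?z l) j s)))"
        by (rule A.real_distribution_distr)
      with True show ?thesis
        by (simp add: real_distribution.char_zero)
    next
      case False
      with that have "s = 0" by simp
      have "local_time M (?z l) j s = 0"
        using local_time_bounds[of M "?z l" j s] z_pos' that \<open>s = 0\<close> by force
      moreover have "AE \<omega> in \<Omega>. P j 0 \<omega> = 0"
        using noise that by (simp add: driving_noise_def poisson_process_def)
      ultimately show ?thesis
        using char_AE_const[OF prob_spaces(1) Y_measurable[OF that(2)]
            component_process_0[OF prob_spaces(1) _ components[OF that(2)]]] by simp
    qed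
    have prod1: "(\<Prod>j=0..M. \<Sum>n=1..N j. complex_of_real (w j n) * ?\<phi> l j (\<theta> j n) s r) = 1"
      if "l \<in> ?S" "s = 0 \<or> r = 0" "0 \<le> s" for l s r
      using \<phi>1[OF that(1) _ that(2,3)] prod_w by simp
    have mass: "(\<Sum>l\<in>?S. complex_of_real (?V l) *
        (\<Prod>j=0..M. \<Sum>n=1..N j. complex_of_real (w j n) * ?\<phi> l j (\<theta> j n) s r)) =
        (\<Sum>l\<in>?S. complex_of_real (?V l))" if "s = 0 \<or> r = 0" "0 \<le> s" for s r
      using prod1[OF _ that] by (intro sum.cong refl) (simp only: mult_1_right)
    \<comment> \<open>The total mass of the density of \<open>X'\<close> at any positive time shows that the weights sum to 1.\<close>
    have "char (distr \<Omega>' borel (X' 1)) 0 = 1"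
      using distributed_measurable[OF X'_density[of 1]]
      by (intro real_distribution.char_zero B.real_distribution_distr) simp
    then have V_sum: "(\<Sum>l\<in>?S. complex_of_real (?V l)) = 1"
      using pos[of 1 0] mass[of 1 0] by simp
    have "char (distr \<Omega>' borel (X' 0)) u = iexp (u * x0)"
      using strong_solution_measurable[OF X'_solution, of 0] X'_solution
      by (intro char_AE_const prob_spaces) (simp_all add: strong_solution_def Let_def)
    then show ?thesis
      unfolding True by (simp only: mass[OF disjI1[OF refl] order_refl] V_sum mult_1_right)
  qed
qed

end
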